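(* Let $A\in\mathbb{C}^{n\times n}$ be normal with orthonormal eigendecomposition $A=\sum_{j=1}^n\lambda_j\boldsymbol{u}_j\boldsymbol{u}_j^*$, where $\boldsymbol{u}_1,\dots,\boldsymbol{u}_n$ is an orthonormal basis of $\mathbb{C}^n$ and $\lambda_1,\dots,\lambda_n\in\mathbb{C}$, and let $\boldsymbol{B}\in\mathbb{C}^{n\times s}$. Let $\theta_1,\dots,\theta_{m-1}\in\mathbb{C}\cup\{\infty\}$ be poles such that every finite $\theta_k$ lies outside the spectrum of $A$, and let $q_{m-1}(z)=\prod_{1\le k\le m-1,\ \theta_k\neq\infty}(z-\theta_k)$. Then, for all matrix-valued rational functions $R(z)$ and $S(z)$ of the form $q_{m-1}(z)^{-1}P(z)$ with $P$ an $s\times s$ matrix polynomial, $$\langle\!\langle R,S\rangle\!\rangle_{A,\boldsymbol{B}}=\sum_{j=1}^n R(\lambda_j)^*\,(\boldsymbol{u}_j^*\boldsymbol{B})^*(\boldsymbol{u}_j^*\boldsymbol{B})\,S(\lambda_j).$$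
   Context: An $s\times s$ matrix polynomial is $P(z)=\sum_{k=0}^{d}z^kC_k$ with $C_k\in\mathbb{C}^{s\times s}$, and $P(A)\circ\boldsymbol{B}=\sum_{k=0}^{d}A^k\boldsymbol{B}C_k\in\mathbb{C}^{n\times s}$. For $R(z)=q_{m-1}(z)^{-1}P(z)$, the action on $(A,\boldsymbol{B})$ is $R(A)\circ\boldsymbol{B}=q_{m-1}(A)^{-1}\,(P(A)\circ\boldsymbol{B})$. The inner product is $\langle\!\langle R,S\rangle\!\rangle_{A,\boldsymbol{B}}=(R(A)\circ\boldsymbol{B})^*\,(S(A)\circ\boldsymbol{B})\in\mathbb{C}^{s\times s}$. An empty product equals $1$. *)

theory Defs
  imports "HOL-Analysis.Analysis" "HOL-Computational_Algebra.Polynomial"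
begin

(* An n x s matrix has type complex^'s^'n. The instances of * and ^ on vec are
   entrywise, so products below are ** and powers are mat_pow; likewise *s would
   scale a matrix by a row, hence the separate scalar multiplication. *)

definition mat_scale :: "complex \<Rightarrow> complex^'b^'a \<Rightarrow> complex^'b^'a"  (infixr "*\<^sub>M" 75)
  where "c *\<^sub>M M = (\<chi> i j. c * M $ i $ j)"

definition ctranspose :: "complex^'b^'a \<Rightarrow> complex^'a^'b"
  where "ctranspose M = (\<chi> i j. cnj (M $ j $ i))"

primrec mat_pow :: "complex^'n^'n \<Rightarrow> nat \<Rightarrow> complex^'n^'n"
  where
    "mat_pow A 0 = mat 1"
  | "mat_pow A (Suc k) = A ** mat_pow A k"

definition poly_mat :: "complex poly \<Rightarrow> complex^'n^'n \<Rightarrow> complex^'n^'n"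
  where "poly_mat q A = (\<Sum>k\<le>degree q. coeff q k *\<^sub>M mat_pow A k)"

definition normal_mat :: "complex^'n^'n \<Rightarrow> bool"
  where "normal_mat A \<longleftrightarrow> A ** ctranspose A = ctranspose A ** A"

definition mat_spectrum :: "complex^'n^'n \<Rightarrow> complex set"
  where "mat_spectrum A = {z. \<exists>v. v \<noteq> 0 \<and> A *v v = z *s v}"

(* The library's inner product on complex^'n is the real one. *)
definition cinner_vec :: "complex^'n \<Rightarrow> complex^'n \<Rightarrow> complex"
  where "cinner_vec x y = (\<Sum>i\<in>UNIV. cnj (x $ i) * y $ i)"

definition orthonormal_basis :: "('n \<Rightarrow> complex^'n) \<Rightarrow> bool"
  where "orthonormal_basis u \<longleftrightarrow>
    (\<forall>i j. cinner_vec (u i) (u j) = (if i = j then 1 else 0)) \<and> vec.span (range u) = UNIV"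

definition col_mat :: "complex^'n \<Rightarrow> complex^1^'n"
  where "col_mat v = columnvector v"

(* Only the additive structure of the type poly is meaningful here: coeff P k is the
   matrix coefficient C_k of z^k. *)
type_synonym 's mat_poly = "(complex^'s^'s) poly"

definition mat_poly_eval :: "'s::finite mat_poly \<Rightarrow> complex \<Rightarrow> complex^'s^'s"
  where "mat_poly_eval P z = (\<Sum>k\<le>degree P. z ^ k *\<^sub>M coeff P k)"

definition mat_poly_action ::
    "'s::finite mat_poly \<Rightarrow> complex^'n^'n \<Rightarrow> complex^'s^'n \<Rightarrow> complex^'s^'n"
  where "mat_poly_action P A B = (\<Sum>k\<le>degree P. mat_pow A k ** B ** coeff P k)"

(* The rational function q(z)^(-1) P(z), given by its denominator and numerator. *)
datatype 's mat_rat = MatRat (denom: "complex poly") (numer: "'s mat_poly")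

definition mat_rat_eval :: "'s::finite mat_rat \<Rightarrow> complex \<Rightarrow> complex^'s^'s"
  where "mat_rat_eval R z = inverse (poly (denom R) z) *\<^sub>M mat_poly_eval (numer R) z"

definition mat_rat_action ::
    "'s::finite mat_rat \<Rightarrow> complex^'n^'n \<Rightarrow> complex^'s^'n \<Rightarrow> complex^'s^'n"
  where "mat_rat_action R A B = matrix_inv (poly_mat (denom R) A) ** mat_poly_action (numer R) A B"

definition block_inner ::
    "complex^'n^'n \<Rightarrow> complex^'s^'n \<Rightarrow> 's::finite mat_rat \<Rightarrow> 's mat_rat \<Rightarrow> complex^'s^'s"
  where "block_inner A B R S = ctranspose (mat_rat_action R A B) ** mat_rat_action S A B"

(* Poles live in the extended complex plane: None is infinity, Some t is the finite pole t. *)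
definition pole_poly :: "(nat \<Rightarrow> complex option) \<Rightarrow> nat \<Rightarrow> complex poly"
  where "pole_poly \<theta> l = (\<Prod>k | k \<in> {1..l} \<and> \<theta> k \<noteq> None. [:- the (\<theta> k), 1:])"

definition mat_rats_with_denom :: "complex poly \<Rightarrow> 's::finite mat_rat set"
  where "mat_rats_with_denom q = range (MatRat q)"

end

theory Submission
  imports Defs
begin

text \<open>Write \<open>e\<^sub>j\<close> for the row \<open>u\<^sub>j\<^sup>*\<close>. It is a left eigenvector of \<open>A\<close>, so \<open>e\<^sub>j (R(A) \<circ> B) = (e\<^sub>j B) R(\<lambda>\<^sub>j)\<close>,
  the denominator being invertible at \<open>A\<close> because no \<open>\<lambda>\<^sub>j\<close> is a pole. Inserting the resolution of
  the identity \<open>\<Sum>\<^sub>j e\<^sub>j\<^sup>* e\<^sub>j = I\<close> between the two factors of the inner product gives the formula.\<close>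

lemma matrix_mult_sum_right:
  fixes A :: "'a::semiring_1^'n^'m"
  shows "A ** (\<Sum>i\<in>I. f i) = (\<Sum>i\<in>I. A ** f i)"
  by (induction I rule: infinite_finite_induct) (auto simp: matrix_add_ldistrib)

lemma matrix_mult_sum_left:
  fixes A :: "'a::semiring_1^'n^'m"
  shows "(\<Sum>i\<in>I. f i) ** A = (\<Sum>i\<in>I. f i ** A)"
  by (simp add: matrix_matrix_mult_def vec_eq_iff sum_distrib_right sum.swap[of _ UNIV I])

lemma mat_scale_mult_left: "(c *\<^sub>M X) ** Y = c *\<^sub>M (X ** Y)"
  by (simp add: mat_scale_def matrix_matrix_mult_def vec_eq_iff sum_distrib_left mult.assoc)

lemma mat_scale_mult_right: "X ** (c *\<^sub>M Y) = c *\<^sub>M (X ** Y)"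
  by (simp add: mat_scale_def matrix_matrix_mult_def vec_eq_iff sum_distrib_left mult.left_commute)

lemma mat_scale_scale: "a *\<^sub>M b *\<^sub>M X = (a * b) *\<^sub>M X"
  by (simp add: mat_scale_def vec_eq_iff mult.assoc)

lemma mat_scale_one: "1 *\<^sub>M X = X"
  by (simp add: mat_scale_def vec_eq_iff)

lemma mat_scale_zero: "0 *\<^sub>M X = 0"
  by (simp add: mat_scale_def vec_eq_iff)

lemma sum_mat_scale: "(\<Sum>i\<in>I. c i *\<^sub>M X) = (\<Sum>i\<in>I. c i) *\<^sub>M X"
  by (simp add: mat_scale_def vec_eq_iff sum_distrib_right)

text \<open>\<open>matrix_inv\<close> is a Hilbert choice among two-sided inverses, so nothing can
  be extracted from it before existence is known.\<close>

lemma matrix_inv_right: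
  fixes A :: "'a::semiring_1^'n^'m"
  assumes "invertible A"
  shows "A ** matrix_inv A = mat 1"
  using someI_ex[OF assms[unfolded invertible_def]] by (simp add: matrix_inv_def)

lemma ctranspose_mult: "ctranspose (X ** Y) = ctranspose Y ** ctranspose X"
  by (simp add: ctranspose_def matrix_matrix_mult_def vec_eq_iff mult.commute)

lemma ctranspose_ctranspose: "ctranspose (ctranspose X) = X"
  by (simp add: ctranspose_def vec_eq_iff)

text \<open>A row times a column is a 1 x 1 matrix. Writing it as a multiple of \<open>mat 1\<close>
  lets orthonormality enter matrix products as a scalar that can be pulled out.\<close>

lemma ctranspose_col_mat_mult_col_mat:
  "ctranspose (col_mat x) ** col_mat y = cinner_vec x y *\<^sub>M mat 1"
  by (simp add: ctranspose_def col_mat_def columnvector_def cinner_vec_def mat_scale_def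
      matrix_matrix_mult_def mat_def vec_eq_iff num1_eq_iff)

text \<open>With the basis vectors as columns of U, orthonormality says U^* U = I. As U is square,
  also U U^* = I, and this product expands into the sum of rank-one projections.\<close>

lemma orthonormal_basis_resolution:
  fixes u :: "'n::finite \<Rightarrow> complex^'n"
  assumes "orthonormal_basis u"
  shows "(\<Sum>j\<in>UNIV. col_mat (u j) ** ctranspose (col_mat (u j))) = mat 1"
proof -
  define U :: "complex^'n^'n" where "U = (\<chi> i j. u j $ i)"
  have "ctranspose U ** U = mat 1"
    using assms by (simp add: orthonormal_basis_def cinner_vec_def U_def ctranspose_def
        matrix_matrix_mult_def mat_def vec_eq_iff)
  then have "U ** ctranspose U = mat 1"
    by (simp add: matrix_left_right_inverse)
  moreover have "(\<Sum>j\<in>UNIV. col_mat (u j) ** ctranspose (col_mat (u j))) = U ** ctranspose U"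
    by (simp add: U_def ctranspose_def col_mat_def columnvector_def matrix_matrix_mult_def vec_eq_iff)
  ultimately show ?thesis by simp
qed

lemma eigendecomposition_left:
  assumes "orthonormal_basis u"
    and "A = (\<Sum>j\<in>UNIV. lam j *\<^sub>M (col_mat (u j) ** ctranspose (col_mat (u j))))"
  shows "ctranspose (col_mat (u i)) ** A = lam i *\<^sub>M ctranspose (col_mat (u i))"
proof -
  have "ctranspose (col_mat (u i)) ** A
      = (\<Sum>j\<in>UNIV. (lam j * cinner_vec (u i) (u j)) *\<^sub>M ctranspose (col_mat (u j)))"
    by (simp add: assms(2) matrix_mult_sum_right mat_scale_mult_right matrix_mul_assoc
        ctranspose_col_mat_mult_col_mat mat_scale_mult_left mat_scale_scale)
  \<comment> \<open>Orthonormality kills every term but the i-th; the conditional form lets the sum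
    collapse.\<close>
  also have "\<dots> = (\<Sum>j\<in>UNIV. if j = i then lam j *\<^sub>M ctranspose (col_mat (u j)) else 0)"
    using assms(1) by (intro sum.cong) (auto simp: orthonormal_basis_def mat_scale_zero)
  finally show ?thesis by simp
qed

text \<open>Column counterpart, since \<open>mat_spectrum\<close> is defined through column
  eigenvectors while the main computation uses rows.\<close>

lemma eigendecomposition_right:
  assumes "orthonormal_basis u"
    and "A = (\<Sum>j\<in>UNIV. lam j *\<^sub>M (col_mat (u j) ** ctranspose (col_mat (u j))))"
  shows "A ** col_mat (u i) = lam i *\<^sub>M col_mat (u i)"
proof -
  have "A ** col_mat (u i)
      = (\<Sum>j\<in>UNIV. (lam j * cinner_vec (u j) (u i)) *\<^sub>M col_mat (u j))"
    \<comment> \<open>Reassociating to the right first exposes the scalar product of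
      \<open>u j\<close> and \<open>u i\<close>, which the second pass evaluates.\<close>
    by (simp add: assms(2) matrix_mult_sum_left mat_scale_mult_left flip: matrix_mul_assoc)
      (simp add: ctranspose_col_mat_mult_col_mat mat_scale_mult_right mat_scale_scale)
  also have "\<dots> = (\<Sum>j\<in>UNIV. if j = i then lam j *\<^sub>M col_mat (u j) else 0)"
    using assms(1) by (intro sum.cong) (auto simp: orthonormal_basis_def mat_scale_zero)
  finally show ?thesis by simp
qed

lemma eigenvalue_in_mat_spectrum:
  assumes "orthonormal_basis u"
    and "A = (\<Sum>j\<in>UNIV. lam j *\<^sub>M (col_mat (u j) ** ctranspose (col_mat (u j))))"
  shows "lam i \<in> mat_spectrum A"
proof -
  have "A *v u i = lam i *s u i"
    using eigendecomposition_right[OF assms, of i]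
    by (simp add: vec_eq_iff matrix_matrix_mult_def matrix_vector_mult_def mat_scale_def
        col_mat_def columnvector_def)
  moreover have "cinner_vec (u i) (u i) = 1"
    using assms(1) by (simp add: orthonormal_basis_def)
  then have "u i \<noteq> 0"
    by (auto simp: cinner_vec_def)
  ultimately show ?thesis
    by (auto simp: mat_spectrum_def)
qed

text \<open>A pole at infinity contributes no factor, so only finite poles have to differ from
  z.\<close>

lemma pole_poly_nonzero:
  assumes "\<And>k t. k \<in> {1..l} \<Longrightarrow> \<theta> k = Some t \<Longrightarrow> t \<noteq> z"
  shows "poly (pole_poly \<theta> l) z \<noteq> 0"
  using assms by (fastforce simp: pole_poly_def poly_prod)

lemma left_eigenvector_mat_pow:
  assumes "e ** A = c *\<^sub>M e"
  shows "e ** mat_pow A k = c ^ k *\<^sub>M e"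
  by (induction k)
    (simp_all add: mat_scale_one matrix_mul_assoc assms mat_scale_mult_left mat_scale_scale)

lemma left_eigenvector_poly_mat:
  assumes "e ** A = c *\<^sub>M e"
  shows "e ** poly_mat q A = poly q c *\<^sub>M e"
  by (simp add: poly_mat_def matrix_mult_sum_right mat_scale_mult_right mat_scale_scale
      left_eigenvector_mat_pow[OF assms] sum_mat_scale poly_altdef)

text \<open>In each term A^k B C_k the powers of A stand leftmost, so e turns them into c^k, while
  the coefficients C_k stay on the right and reassemble to P(c).\<close>

lemma left_eigenvector_mat_poly_action:
  assumes "e ** A = c *\<^sub>M e"
  shows "e ** mat_poly_action P A B = e ** B ** mat_poly_eval P c"
  by (simp add: mat_poly_action_def mat_poly_eval_def matrix_mult_sum_right matrix_mul_assoc
      left_eigenvector_mat_pow[OF assms] mat_scale_mult_left mat_scale_mult_right)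

lemma left_eigenvector_mat_rat_action:
  assumes "e ** A = c *\<^sub>M e" and "poly (denom R) c \<noteq> 0" and "invertible (poly_mat (denom R) A)"
  shows "e ** mat_rat_action R A B = e ** B ** mat_rat_eval R c"
proof -
  let ?Q = "poly_mat (denom R) A"
  \<comment> \<open>Inserting Q Q^(-1) turns the known action of e on Q into its action on Q^(-1),
    after division by q(c).\<close>
  have "e = e ** ?Q ** matrix_inv ?Q"
    using assms(3) by (simp add: matrix_inv_right flip: matrix_mul_assoc)
  also have "\<dots> = poly (denom R) c *\<^sub>M (e ** matrix_inv ?Q)"
    by (simp add: left_eigenvector_poly_mat[OF assms(1)] mat_scale_mult_left)
  finally have "inverse (poly (denom R) c) *\<^sub>M e
      = inverse (poly (denom R) c) *\<^sub>M poly (denom R) c *\<^sub>M (e ** matrix_inv ?Q)"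
    by simp
  then have "e ** matrix_inv ?Q = inverse (poly (denom R) c) *\<^sub>M e"
    using assms(2) by (simp add: mat_scale_scale mat_scale_one)
  then show ?thesis
    by (simp add: mat_rat_action_def mat_rat_eval_def matrix_mul_assoc mat_scale_mult_left
        mat_scale_mult_right)
      (simp add: left_eigenvector_mat_poly_action[OF assms(1)])
qed

text \<open>The spectral formula supplies an explicit left inverse, the sum of q(lam_j)^(-1) u_j
  u_j^*; for square matrices a left inverse suffices.\<close>

lemma invertible_poly_mat:
  fixes A :: "complex^'n::finite^'n"
  assumes "orthonormal_basis u"
    and "\<And>j. ctranspose (col_mat (u j)) ** A = lam j *\<^sub>M ctranspose (col_mat (u j))"
    and "\<And>j. poly q (lam j) \<noteq> 0"
  shows "invertible (poly_mat q A)"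
proof -
  have "(\<Sum>j\<in>UNIV. inverse (poly q (lam j)) *\<^sub>M (col_mat (u j) ** ctranspose (col_mat (u j)))) ** poly_mat q A
      = (\<Sum>j\<in>UNIV. col_mat (u j) ** ctranspose (col_mat (u j)))"
    by (simp add: matrix_mult_sum_left mat_scale_mult_left flip: matrix_mul_assoc)
      (simp add: left_eigenvector_poly_mat[OF assms(2)] mat_scale_mult_right mat_scale_scale
        assms(3) mat_scale_one)
  then show ?thesis
    unfolding invertible_left_inverse orthonormal_basis_resolution[OF assms(1)] by blast
qed

theorem theorem3p4:
  fixes A :: "complex^'n^'n" and B :: "complex^'s^'n"
    and u :: "'n \<Rightarrow> complex^'n" and lam :: "'n \<Rightarrow> complex"
    and m :: nat and \<theta> :: "nat \<Rightarrow> complex option"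
    and R S :: "'s mat_rat"
  assumes "normal_mat A"
    and "orthonormal_basis u"
    and "A = (\<Sum>j\<in>UNIV. lam j *\<^sub>M (col_mat (u j) ** ctranspose (col_mat (u j))))"
    and "m \<ge> 1"
    and "\<And>k t. k \<in> {1..m - 1} \<Longrightarrow> \<theta> k = Some t \<Longrightarrow> t \<notin> mat_spectrum A"
    and "R \<in> mat_rats_with_denom (pole_poly \<theta> (m - 1))"
    and "S \<in> mat_rats_with_denom (pole_poly \<theta> (m - 1))"
  shows "block_inner A B R S =
    (\<Sum>j\<in>UNIV. ctranspose (mat_rat_eval R (lam j))
       ** (ctranspose (ctranspose (col_mat (u j)) ** B) ** (ctranspose (col_mat (u j)) ** B))
       ** mat_rat_eval S (lam j))"
proof -
  let ?e = "\<lambda>j. ctranspose (col_mat (u j))"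
  define q where "q = pole_poly \<theta> (m - 1)"
  have left: "?e j ** A = lam j *\<^sub>M ?e j" for j
    by (rule eigendecomposition_left[OF assms(2,3)])
  have nz: "poly q (lam j) \<noteq> 0" for j
    unfolding q_def
    by (rule pole_poly_nonzero) (use assms(5) eigenvalue_in_mat_spectrum[OF assms(2,3)] in blast)
  have inv: "invertible (poly_mat q A)"
    by (rule invertible_poly_mat[OF assms(2) left nz])
  have denom: "denom R = q" "denom S = q"
    using assms(6,7) by (auto simp: mat_rats_with_denom_def q_def)
  have R: "?e j ** mat_rat_action R A B = ?e j ** B ** mat_rat_eval R (lam j)"
    and S: "?e j ** mat_rat_action S A B = ?e j ** B ** mat_rat_eval S (lam j)" for j
    by (rule left_eigenvector_mat_rat_action[OF left]; simp add: denom nz inv)+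
  have "block_inner A B R S = ctranspose (mat_rat_action R A B)
      ** (\<Sum>j\<in>UNIV. col_mat (u j) ** ?e j) ** mat_rat_action S A B"
    by (simp add: block_inner_def orthonormal_basis_resolution[OF assms(2)])
  \<comment> \<open>Each \<open>col_mat (u j)\<close> equals \<open>ctranspose (?e j)\<close>, so it
    joins the transposed action of R on its left.\<close>
  also have "\<dots> = (\<Sum>j\<in>UNIV. ctranspose (?e j ** mat_rat_action R A B)
      ** (?e j ** mat_rat_action S A B))"
    by (simp add: matrix_mult_sum_left matrix_mult_sum_right ctranspose_mult ctranspose_ctranspose
        matrix_mul_assoc)
  also have "\<dots> = (\<Sum>j\<in>UNIV. ctranspose (mat_rat_eval R (lam j))
      ** (ctranspose (?e j ** B) ** (?e j ** B)) ** mat_rat_eval S (lam j))"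
    unfolding R S by (simp add: ctranspose_mult matrix_mul_assoc)
  finally show ?thesis .
qed

end
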